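(* (Random Target Lemma for OQWs) Let $\Phi$ be a finite ergodic open quantum random walk with degree of freedom $n\ge 2$ and $k\ge 2$ sites, and let $\hat K=(\hat k_{ij})$ be its mean hitting time operator. Let $\hat D$ be the block-diagonal operator with diagonal entries $\hat k_{11},\dots,\hat k_{kk}$ and let $\hat N:=\hat K-\hat D$. Suppose that $\hat D$ is invertible and that there is a constant $c$ such that $\mathrm{Tr}(\hat k_{ii}\eta)=c\,\mathrm{Tr}(\eta)$ for all $i=1,\dots,k$ and all $\eta\in M_n(\mathbb C)$. Then for every density matrix $\rho\in M_n(\mathbb C)$ the quantity $$t_{\odot}(\rho):=\sum_{i=1}^k \mathrm{Tr}\big((\hat D^{-1}\hat N)_{ij}\rho\big)$$ does not depend on $j\in\{1,\dots,k\}$.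
   Context: OQW. Let $k$ (number of sites) and $n$ (degree of freedom) be positive integers. A finite open quantum random walk (OQW) $\Phi$ is given by matrices $B_{ij}\in M_n(\mathbb C)$, $i,j=1,\dots,k$, with $\sum_{i=1}^k B_{ij}^*B_{ij}=I$ for each $j$; $B_{ij}$ is the effect of passing from site $j$ to site $i$. For $C\in M_n(\mathbb C)$ let $M_C:M_n(\mathbb C)\to M_n(\mathbb C)$, $M_C(X)=CXC^*$. Block operators. A block operator is a $k\times k$ array $\hat A=(\hat A_{ij})$ of linear maps $\hat A_{ij}:M_n(\mathbb C)\to M_n(\mathbb C)$, acting on column vectors in $M_n(\mathbb C)^k$; products are block matrix products, $(\hat A\hat B)_{ij}=\sum_{l}\hat A_{il}\hat B_{lj}$ (composition of maps). $\hat A_{ij}\rho$ denotes $\hat A_{ij}(\rho)$. The block representation of $\Phi$ is $\hat\Phi=(\hat\Phi_{ij})$, $\hat\Phi_{ij}=M_{B_{ij}}$. Ergodicity. $\hat\Omega$ is the block operator all of whose blocks $\hat\Omega_{pq}$, $p,q=1,\dots,k$, are equal to $X\mapsto\frac{1}{kn}\mathrm{Tr}(X)I_n$ (with respect to row-stacking vectorization, its matrix is $\frac1{kn}\sum_{a,b=1}^nE_{ab}\otimes E_{ab}$ with $E_{ab}\in M_n(\mathbb C)$ the matrix units). $\Phi$ is called ergodic if $\hat\Phi^r\to\hat\Omega$ as $r\to\infty$ (entrywise convergence of matrix representations). Mean hitting time operator. For $r\ge1$ let $\pi(i\leftarrow j;r)$ be the collection of products $C=B_{i_r i_{r-1}}\cdots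 B_{i_2i_1}B_{i_1i_0}$, one for each sequence of sites with $i_0=j$, $i_r=i$ and $i_1,\dots,i_{r-1}\neq i$ (first visit to $i$ after time $0$ at step $r$; for $i=j$, first return). Then $\hat K=(\hat k_{ij})_{i,j=1}^k$ with $\hat k_{ij}:=\sum_{r\ge1} r\sum_{C\in\pi(i\leftarrow j;r)}M_C$. A density matrix is a positive semidefinite $\rho\in M_n(\mathbb C)$ with $\mathrm{Tr}(\rho)=1$. *)

theory Defs
  imports "HOL-Analysis.Analysis"
begin

text \<open>
  The \<open>k\<close> sites are the elements of a finite type \<open>'k\<close>, and \<open>M\<^sub>n(\<complex>)\<close> is the type
  \<^typ>\<open>complex^'n^'n\<close>, so that \<open>k = CARD('k)\<close> and \<open>n = CARD('n)\<close>.
\<close>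

type_synonym 'n cmat = "complex^'n^'n"

definition adjoint_mat :: "'n::finite cmat \<Rightarrow> 'n cmat" where
  "adjoint_mat A = (\<chi> i j. cnj (A $ j $ i))"

definition psd :: "'n::finite cmat \<Rightarrow> bool" where
  "psd A \<longleftrightarrow> adjoint_mat A = A \<and>
     (\<forall>v :: complex^'n. 0 \<le> Re (\<Sum>a\<in>UNIV. cnj (v $ a) * (A *v v) $ a))"

definition density_matrix :: "'n::finite cmat \<Rightarrow> bool" where
  "density_matrix \<rho> \<longleftrightarrow> psd \<rho> \<and> trace \<rho> = 1"

definition conj_map :: "'n::finite cmat \<Rightarrow> 'n cmat \<Rightarrow> 'n cmat" where
  "conj_map C X = C ** X ** adjoint_mat C"

text \<open>
  Block operators. \<^typ>\<open>complex^'n^'n\<close> carries only a real vector space structure in the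
  library, so complex scaling is spelled out; \<open>is_block_op\<close> asks for complex linearity
  of every block.
\<close>

definition cscale :: "complex \<Rightarrow> 'n::finite cmat \<Rightarrow> 'n cmat" where
  "cscale c = map_matrix ((*) c)"

lemma vector_space_cscale: "vector_space (cscale :: complex \<Rightarrow> 'n::finite cmat \<Rightarrow> 'n cmat)"
  by unfold_locales (simp_all add: cscale_def vec_eq_iff algebra_simps)

type_synonym ('k, 'n) block_op = "'k \<Rightarrow> 'k \<Rightarrow> 'n cmat \<Rightarrow> 'n cmat"

definition is_block_op :: "('k::finite, 'n::finite) block_op \<Rightarrow> bool" where
  "is_block_op A \<longleftrightarrow> (\<forall>i j. Vector_Spaces.linear cscale cscale (A i j))"

definition block_one :: "('k::finite, 'n::finite) block_op" where
  "block_one i j X = (if i = j then X else 0)"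

definition block_mult ::
  "('k::finite, 'n::finite) block_op \<Rightarrow> ('k, 'n) block_op \<Rightarrow> ('k, 'n) block_op" where
  "block_mult A B i j X = (\<Sum>l\<in>UNIV. A i l (B l j X))"

primrec block_power :: "('k::finite, 'n::finite) block_op \<Rightarrow> nat \<Rightarrow> ('k, 'n) block_op" where
  "block_power A 0 = block_one"
| "block_power A (Suc r) = block_mult A (block_power A r)"

definition is_block_inverse ::
  "('k::finite, 'n::finite) block_op \<Rightarrow> ('k, 'n) block_op \<Rightarrow> bool" where
  "is_block_inverse A B \<longleftrightarrow>
     is_block_op B \<and> block_mult A B = block_one \<and> block_mult B A = block_one"

definition block_invertible :: "('k::finite, 'n::finite) block_op \<Rightarrow> bool" where
  "block_invertible A \<longleftrightarrow> (\<exists>B. is_block_inverse A B)"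

definition block_inv :: "('k::finite, 'n::finite) block_op \<Rightarrow> ('k, 'n) block_op" where
  "block_inv A = (SOME B. is_block_inverse A B)"

text \<open>
  Matrix of a linear map with respect to row-stacking vectorization: rows and columns are
  indexed by pairs, and \<open>axis c (axis d 1)\<close> is the matrix unit \<open>E\<^bsub>cd\<^esub>\<close>.
\<close>

definition matrix_rep :: "('n::finite cmat \<Rightarrow> 'n cmat) \<Rightarrow> complex^('n \<times> 'n)^('n \<times> 'n)" where
  "matrix_rep f = (\<chi> p q. f (axis (fst q) (axis (snd q) 1)) $ fst p $ snd p)"

text \<open>Open quantum walks. \<open>B i j\<close> is the effect of passing from site \<open>j\<close> to site \<open>i\<close>.\<close>

definition oqw :: "('k::finite \<Rightarrow> 'k \<Rightarrow> 'n::finite cmat) \<Rightarrow> bool" where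
  "oqw B \<longleftrightarrow> (\<forall>j. (\<Sum>i\<in>UNIV. adjoint_mat (B i j) ** B i j) = mat 1)"

definition block_rep :: "('k::finite \<Rightarrow> 'k \<Rightarrow> 'n::finite cmat) \<Rightarrow> ('k, 'n) block_op" where
  "block_rep B i j = conj_map (B i j)"

definition Omega_op :: "('k::finite, 'n::finite) block_op" where
  "Omega_op p q X = cscale (trace X / of_nat (CARD('k) * CARD('n))) (mat 1)"

definition ergodic :: "('k::finite \<Rightarrow> 'k \<Rightarrow> 'n::finite cmat) \<Rightarrow> bool" where
  "ergodic B \<longleftrightarrow>
     (\<forall>p q a b. (\<lambda>r. matrix_rep (block_power (block_rep B) r p q) $ a $ b)
        \<longlonglongrightarrow> matrix_rep (Omega_op p q :: 'n cmat \<Rightarrow> 'n cmat) $ a $ b)"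

text \<open>
  A list \<open>[i\<^sub>0, \<dots>, i\<^sub>r]\<close> of sites, in order of time, records a walk. Sums run over the walks
  and not over the set of their products, so products that coincide for different walks
  are counted separately.
\<close>

definition first_visit_walks :: "'k \<Rightarrow> 'k \<Rightarrow> nat \<Rightarrow> 'k list set" where
  "first_visit_walks i j r =
     {s. length s = Suc r \<and> s ! 0 = j \<and> s ! r = i \<and> (\<forall>m. 1 \<le> m \<and> m < r \<longrightarrow> s ! m \<noteq> i)}"

fun walk_product :: "('k \<Rightarrow> 'k \<Rightarrow> 'n::finite cmat) \<Rightarrow> 'k list \<Rightarrow> 'n cmat" where
  "walk_product B (x # y # s) = walk_product B (y # s) ** B y x"
| "walk_product B s = mat 1"

text \<open>The index \<open>r\<close> of the series is shifted by one, because walks have length at least 1.\<close>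

definition hitting_op :: "('k::finite \<Rightarrow> 'k \<Rightarrow> 'n::finite cmat) \<Rightarrow> ('k, 'n) block_op" where
  "hitting_op B i j X =
     (\<Sum>r. of_nat (Suc r) *\<^sub>R
        (\<Sum>s\<in>first_visit_walks i j (Suc r). conj_map (walk_product B s) X))"

definition hitting_diag :: "('k::finite \<Rightarrow> 'k \<Rightarrow> 'n::finite cmat) \<Rightarrow> ('k, 'n) block_op" where
  "hitting_diag B i j X = (if i = j then hitting_op B i i X else 0)"

definition hitting_offdiag :: "('k::finite \<Rightarrow> 'k \<Rightarrow> 'n::finite cmat) \<Rightarrow> ('k, 'n) block_op" where
  "hitting_offdiag B i j X = hitting_op B i j X - hitting_diag B i j X"

definition target_time :: "('k::finite \<Rightarrow> 'k \<Rightarrow> 'n::finite cmat) \<Rightarrow> 'k \<Rightarrow> 'n cmat \<Rightarrow> complex" where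
  "target_time B j \<rho> =
     (\<Sum>i\<in>UNIV. trace (block_mult (block_inv (hitting_diag B)) (hitting_offdiag B) i j \<rho>))"

end

theory Submission
  imports Defs
begin

text \<open>
  Conditioning on the first step gives
  \<open>Tr (k\<^sub>i\<^sub>j X) = Tr X + (\<Sum>l\<noteq>i. Tr (k\<^sub>i\<^sub>l (\<Phi>\<^sub>l\<^sub>j X)))\<close>. Summing over \<open>i\<close>, the functionals
  \<open>f\<^sub>j X = (\<Sum>i\<noteq>j. Tr (k\<^sub>i\<^sub>j X))\<close> satisfy \<open>f\<^sub>j X = (k - c) Tr X + (\<Sum>l. f\<^sub>l (\<Phi>\<^sub>l\<^sub>j X))\<close>.
  Iterating \<open>r\<close> times and subtracting two starting sites, the trace terms cancel and
  \<open>f\<^sub>j X - f\<^sub>j\<^sub>' X\<close> is the difference of the sums of \<open>f\<^sub>l\<close> over the columns \<open>j\<close> and \<open>j'\<close> of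
  \<open>\<Phi>\<^sup>r X\<close>; it vanishes in the limit because all columns of \<open>\<Omega>\<close> agree. The trace hypothesis on
  \<open>k\<^sub>i\<^sub>i\<close> makes \<open>D\<^sup>-\<^sup>1\<close> divide traces by \<open>c\<close>, so the target time is \<open>f\<^sub>j / c\<close>. The series
  defining \<open>k\<^sub>i\<^sub>j\<close> converge since, by ergodicity, the probability of not yet having visited \<open>i\<close>
  decays geometrically.
\<close>

section \<open>Complex-linear maps and their coordinates\<close>

lemma linear_cscaleI:
  assumes "\<And>X Y. f (X + Y) = f X + f Y" "\<And>c X. f (cscale c X) = cscale c (f X)"
  shows "Vector_Spaces.linear cscale cscale f"
  unfolding Vector_Spaces.linear_iff by (intro conjI allI vector_space_cscale assms)

lemma
  assumes "Vector_Spaces.linear cscale cscale f"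
  shows linear_cscale_add: "f (X + Y) = f X + f Y"
    and linear_cscale_scale: "f (cscale c X) = cscale c (f X)"
    and linear_cscale_sum: "f (sum g S) = (\<Sum>x\<in>S. f (g x))"
proof -
  interpret Vector_Spaces.linear cscale cscale f by (rule assms)
  show "f (X + Y) = f X + f Y" "f (cscale c X) = cscale c (f X)"
    "f (sum g S) = (\<Sum>x\<in>S. f (g x))"
    by (simp_all add: add scale sum)
qed

lemma cscale_nth [simp]: "cscale c X $ a $ b = c * X $ a $ b"
  by (simp add: cscale_def)

lemma cscale_add_right: "cscale c (X + Y) = cscale c X + cscale c Y"
  by (simp add: vec_eq_iff algebra_simps)

lemma cscale_sum_right: "cscale c (sum g S) = (\<Sum>x\<in>S. cscale c (g x))"
  by (induction S rule: infinite_finite_induct) (simp_all add: cscale_add_right vec_eq_iff)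

lemma scaleR_eq_cscale: "r *\<^sub>R X = cscale (of_real r) X"
  by (simp add: vec_eq_iff) (simp add: scaleR_conv_of_real)

lemma linear_cscale_imp_linear:
  assumes "Vector_Spaces.linear cscale cscale f"
  shows "linear f"
  by (rule linearI) (simp_all add: scaleR_eq_cscale linear_cscale_add[OF assms] linear_cscale_scale[OF assms])

lemma matrix_unit_expansion:
  "X = (\<Sum>c\<in>UNIV. \<Sum>d\<in>UNIV. cscale (X $ c $ d) (axis c (axis d 1)))"
proof -
  have "(\<Sum>c\<in>UNIV. \<Sum>d\<in>UNIV. X $ c $ d * axis c (axis d 1) $ a $ b) = X $ a $ b" for a b
  proof -
    have "(\<Sum>c\<in>UNIV. \<Sum>d\<in>UNIV. X $ c $ d * axis c (axis d 1) $ a $ b)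
        = (\<Sum>c\<in>UNIV. \<Sum>d\<in>UNIV. if c = a then (if d = b then X $ c $ d else 0) else 0)"
      by (intro sum.cong refl) (auto simp: axis_def)
    also have "\<dots> = (\<Sum>c\<in>UNIV. if c = a then X $ c $ b else 0)"
      by (intro sum.cong refl) (auto)
    also have "\<dots> = X $ a $ b" by simp
    finally show ?thesis .
  qed
  then show ?thesis by (simp add: vec_eq_iff)
qed

lemma linear_cscale_expansion:
  assumes "Vector_Spaces.linear cscale cscale f"
  shows "f X = (\<Sum>c\<in>UNIV. \<Sum>d\<in>UNIV. cscale (X $ c $ d) (f (axis c (axis d 1))))"
  by (subst matrix_unit_expansion[of X])
     (simp add: linear_cscale_sum[OF assms] linear_cscale_scale[OF assms])

lemma linear_cscale_matrix_rep:
  assumes "Vector_Spaces.linear cscale cscale f"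
  shows "f X $ a $ b = (\<Sum>c\<in>UNIV. \<Sum>d\<in>UNIV. X $ c $ d * matrix_rep f $ (a, b) $ (c, d))"
  by (subst linear_cscale_expansion[OF assms]) (simp add: matrix_rep_def)

section \<open>Conjugation maps, traces and norms\<close>

lemma adjoint_mat_mult: "adjoint_mat (A ** B) = adjoint_mat B ** adjoint_mat A"
  by (simp add: adjoint_mat_def matrix_matrix_mult_def vec_eq_iff mult.commute)

lemma adjoint_mat_one [simp]: "adjoint_mat (mat 1) = mat 1"
  by (auto simp: adjoint_mat_def mat_def vec_eq_iff)

lemma conj_map_mult: "conj_map (A ** B) X = conj_map A (conj_map B X)"
  by (simp add: conj_map_def adjoint_mat_mult matrix_mul_assoc)

text \<open>Each factor evolves by left multiplication alone, so a matrix that need not be positive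
  can be followed through the walk by two separate factors.\<close>

lemma conj_map_mult_adjoint: "conj_map C (X ** adjoint_mat Y) = (C ** X) ** adjoint_mat (C ** Y)"
  by (simp add: conj_map_def adjoint_mat_mult matrix_mul_assoc)

lemma linear_conj_map: "Vector_Spaces.linear cscale cscale (conj_map C)"
proof (rule linear_cscaleI)
  show "conj_map C (X + Y) = conj_map C X + conj_map C Y" for X Y
    by (simp add: conj_map_def matrix_matrix_mult_def vec_eq_iff sum.distrib distrib_left distrib_right)
  show "conj_map C (cscale c X) = cscale c (conj_map C X)" for c X
    by (simp add: conj_map_def matrix_matrix_mult_def vec_eq_iff sum_distrib_left sum_distrib_right mult_ac)
qed

lemma trace_sum: "trace (sum g S) = (\<Sum>x\<in>S. trace (g x :: complex^'n^'n))"
  by (induction S rule: infinite_finite_induct) (simp_all add: trace_add trace_0[unfolded mat_0])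

lemma trace_cscale [simp]: "trace (cscale c X) = c * trace X"
  by (simp add: trace_def sum_distrib_left)

lemma bounded_linear_trace: "bounded_linear (trace :: complex^'n^'n \<Rightarrow> complex)"
  by (rule linear_conv_bounded_linear[THEN iffD1], rule linearI)
     (simp_all add: trace_add scaleR_eq_cscale scaleR_conv_of_real)

text \<open>The norm of nested vectors is the Frobenius norm, so the mass of the state
  \<open>Y ** adjoint_mat Y\<close> is a sum of squared entries.\<close>

lemma trace_mult_adjoint: "trace (Y ** adjoint_mat Y) = of_real ((norm Y)\<^sup>2)"
proof -
  have "(norm Y)\<^sup>2 = (\<Sum>a\<in>UNIV. \<Sum>b\<in>UNIV. (norm (Y $ a $ b))\<^sup>2)"
    by (simp add: norm_vec_def L2_set_def sum_nonneg)
  then show ?thesis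
    by (simp add: trace_def matrix_matrix_mult_def adjoint_mat_def complex_norm_square del: of_real_power)
qed

text \<open>The bilinear bound \<open>K * norm X * norm Y\<close> is weakened to squares because
  squared norms are masses, which add up along the walk.\<close>

lemma norm_mult_adjoint_bound:
  "\<exists>K>0. \<forall>(X :: 'n::finite cmat) (Y :: 'n cmat). norm (X ** adjoint_mat Y) \<le> K * ((norm X)\<^sup>2 + (norm Y)\<^sup>2)"
proof -
  have "bilinear (\<lambda>(X :: 'n cmat) (Y :: 'n cmat). X ** adjoint_mat Y)"
    unfolding bilinear_def
    by (auto intro!: linearI simp: vec_eq_iff matrix_matrix_mult_def adjoint_mat_def
        algebra_simps sum.distrib scaleR_sum_right)
  from bilinear_bounded_pos[OF this] obtain K
    where K: "K > 0" "\<And>(X :: 'n cmat) (Y :: 'n cmat). norm (X ** adjoint_mat Y) \<le> K * norm X * norm Y"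
    by blast
  have "norm (X ** adjoint_mat Y) \<le> K * ((norm X)\<^sup>2 + (norm Y)\<^sup>2)" for X Y :: "complex^'n^'n"
  proof -
    have "norm X * norm Y \<le> (norm X)\<^sup>2 + (norm Y)\<^sup>2"
      using sum_squares_bound[of "norm X" "norm Y"] mult_nonneg_nonneg[OF norm_ge_zero norm_ge_zero, of X Y]
      by linarith
    with K(1) have "K * (norm X * norm Y) \<le> K * ((norm X)\<^sup>2 + (norm Y)\<^sup>2)" by simp
    with K(2)[of X Y] show ?thesis by (simp add: mult.assoc)
  qed
  with K(1) show ?thesis by blast
qed

lemma sum_matrix_mult: "(\<Sum>x\<in>S. A x) ** X = (\<Sum>x\<in>S. A x ** X)"
  by (induction S rule: infinite_finite_induct)
     (simp_all add: matrix_matrix_mult_def vec_eq_iff distrib_right sum.distrib)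

section \<open>Conservation of mass and survival probabilities\<close>

lemma oqw_trace:
  assumes "oqw B"
  shows "(\<Sum>i\<in>UNIV. trace (conj_map (B i j) X)) = trace X"
proof -
  have "trace (conj_map (B i j) X) = trace ((adjoint_mat (B i j) ** B i j) ** X)" for i
    by (metis conj_map_def matrix_mul_assoc trace_mul_sym)
  then have "(\<Sum>i\<in>UNIV. trace (conj_map (B i j) X))
      = trace ((\<Sum>i\<in>UNIV. adjoint_mat (B i j) ** B i j) ** X)"
    by (simp only: sum_matrix_mult trace_sum)
  then show ?thesis using assms by (simp add: oqw_def)
qed

text \<open>This is trace preservation read at the state \<open>Y ** adjoint_mat Y\<close>.\<close>

lemma oqw_norm:
  fixes B :: "'k::finite \<Rightarrow> 'k \<Rightarrow> 'n::finite cmat" and Y :: "'n cmat"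
  assumes "oqw B"
  shows "(\<Sum>i\<in>UNIV. (norm (B i j ** Y))\<^sup>2) = (norm Y)\<^sup>2"
proof -
  have "complex_of_real (\<Sum>i\<in>UNIV. (norm (B i j ** Y))\<^sup>2) = of_real ((norm Y)\<^sup>2)"
    using oqw_trace[OF assms, of j "Y ** adjoint_mat Y"]
    by (simp only: conj_map_mult_adjoint trace_mult_adjoint of_real_sum)
  then show ?thesis by (simp only: of_real_eq_iff)
qed

text \<open>The probability, from site \<open>j\<close> with unnormalised state \<open>Y ** adjoint_mat Y\<close>, of avoiding \<open>i\<close>
  at the times \<open>1, \<dots>, r\<close>.\<close>

primrec survival :: "('k::finite \<Rightarrow> 'k \<Rightarrow> 'n::finite cmat) \<Rightarrow> 'k \<Rightarrow> nat \<Rightarrow> 'k \<Rightarrow> 'n cmat \<Rightarrow> real" where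
  "survival B i 0 j Y = (norm Y)\<^sup>2"
| "survival B i (Suc r) j Y = (\<Sum>l\<in>UNIV-{i}. survival B i r l (B l j ** Y))"

lemma survival_nonneg: "survival B i r j Y \<ge> 0"
  by (induction r arbitrary: j Y) (auto intro: sum_nonneg)

lemma survival_le:
  assumes "oqw B"
  shows "survival B i r j Y \<le> (norm Y)\<^sup>2"
proof (induction r arbitrary: j Y)
  case (Suc r)
  have "survival B i (Suc r) j Y \<le> (\<Sum>l\<in>UNIV-{i}. (norm (B l j ** Y))\<^sup>2)"
    by (auto intro: sum_mono Suc)
  also have "\<dots> \<le> (\<Sum>l\<in>UNIV. (norm (B l j ** Y))\<^sup>2)"
    by (rule sum_mono2) auto
  finally show ?case by (simp add: oqw_norm[OF assms])
qed simp

text \<open>Markov property: the bound for the last \<open>s\<close> steps is uniform in site and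
  state, so it applies wherever the first \<open>r\<close> steps lead.\<close>

lemma survival_add_le:
  assumes "\<And>l Z. survival B i s l Z \<le> a * (norm Z)\<^sup>2"
  shows "survival B i (r + s) j Y \<le> a * survival B i r j Y"
  by (induction r arbitrary: j Y) (auto simp: assms sum_distrib_left intro: sum_mono)

text \<open>\<open>G\<close> is kept abstract to serve both the matrix-valued first-visit operators
  and the complex-valued mass that has not yet visited \<open>i\<close>. Both unfold by a first step
  that avoids \<open>i\<close>, exactly as \<open>survival\<close> does.\<close>

lemma taboo_recursion_bound:
  fixes G :: "nat \<Rightarrow> 'k::finite \<Rightarrow> 'n::finite cmat \<Rightarrow> 'a::real_normed_vector"
  assumes rec: "\<And>r j X. G (Suc r) j X = (\<Sum>l\<in>UNIV-{i}. G r l (conj_map (B l j) X))"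
    and base: "\<And>j X Y. norm (G 0 j (X ** adjoint_mat Y)) \<le> K * ((norm X)\<^sup>2 + (norm Y)\<^sup>2)"
  shows "norm (G r j (X ** adjoint_mat Y)) \<le> K * (survival B i r j X + survival B i r j Y)"
proof (induction r arbitrary: j X Y)
  case 0
  then show ?case using base by simp
next
  case (Suc r)
  have "norm (G (Suc r) j (X ** adjoint_mat Y))
      \<le> (\<Sum>l\<in>UNIV-{i}. norm (G r l ((B l j ** X) ** adjoint_mat (B l j ** Y))))"
    unfolding rec conj_map_mult_adjoint by (rule norm_sum)
  also have "\<dots> \<le> (\<Sum>l\<in>UNIV-{i}. K * (survival B i r l (B l j ** X) + survival B i r l (B l j ** Y)))"
    by (intro sum_mono Suc)
  finally show ?case by (simp add: sum.distrib sum_distrib_left distrib_left)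
qed

section \<open>Powers of the block representation\<close>

lemma block_power_block_rep_Suc:
  "block_power (block_rep B) (Suc r) i j X
     = (\<Sum>l\<in>UNIV. conj_map (B i l) (block_power (block_rep B) r l j X))"
  by (simp add: block_mult_def block_rep_def)

lemma linear_block_power:
  "Vector_Spaces.linear cscale cscale (block_power (block_rep B) r i j)"
proof (induction r arbitrary: i j)
  case 0
  show ?case by (rule linear_cscaleI) (auto simp: block_one_def vec_eq_iff)
next
  case (Suc r)
  show ?case
    by (rule linear_cscaleI)
       (simp_all add: block_power_block_rep_Suc linear_cscale_add[OF Suc] linear_cscale_scale[OF Suc]
         linear_cscale_add[OF linear_conj_map] linear_cscale_scale[OF linear_conj_map]
         sum.distrib cscale_sum_right del: block_power.simps)
qed

text \<open>\<open>block_power\<close> splits off the last step; conditioning on the first step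
  needs the other end.\<close>

lemma block_power_Suc_right:
  "block_power (block_rep B) (Suc r) i j X
     = (\<Sum>l\<in>UNIV. block_power (block_rep B) r i l (conj_map (B l j) X))"
proof (induction r arbitrary: i j X)
  case 0
  have "(\<Sum>l\<in>UNIV. conj_map (B i l) (if l = j then X else 0)) = (\<Sum>l\<in>UNIV. if l = j then conj_map (B i l) X else 0)"
    by (intro sum.cong refl) (simp add: conj_map_def)
  then show ?case by (simp add: block_mult_def block_rep_def block_one_def)
next
  case (Suc r)
  have "block_power (block_rep B) (Suc (Suc r)) i j X
      = (\<Sum>m\<in>UNIV. conj_map (B i m) (block_power (block_rep B) (Suc r) m j X))"
    by (rule block_power_block_rep_Suc)
  also have "\<dots> = (\<Sum>m\<in>UNIV. \<Sum>l\<in>UNIV. conj_map (B i m) (block_power (block_rep B) r m l (conj_map (B l j) X)))"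
    by (simp only: Suc linear_cscale_sum[OF linear_conj_map])
  also have "\<dots> = (\<Sum>l\<in>UNIV. \<Sum>m\<in>UNIV. conj_map (B i m) (block_power (block_rep B) r m l (conj_map (B l j) X)))"
    by (rule sum.swap)
  finally show ?case by (simp only: block_power_block_rep_Suc)
qed

lemma trace_block_power:
  assumes "oqw B"
  shows "(\<Sum>i\<in>UNIV. trace (block_power (block_rep B) r i j X)) = trace X"
proof (induction r arbitrary: j X)
  case 0
  have "(\<Sum>i\<in>UNIV. trace (if i = j then X else 0)) = (\<Sum>i\<in>UNIV. if i = j then trace X else 0)"
    by (intro sum.cong refl) (simp add: trace_def)
  then show ?case by (simp add: block_one_def)
next
  case (Suc r)
  have "(\<Sum>i\<in>UNIV. trace (block_power (block_rep B) (Suc r) i j X))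
     = (\<Sum>i\<in>UNIV. \<Sum>l\<in>UNIV. trace (block_power (block_rep B) r i l (conj_map (B l j) X)))"
    by (simp only: block_power_Suc_right trace_sum)
  also have "\<dots> = (\<Sum>l\<in>UNIV. trace (conj_map (B l j) X))"
    by (subst sum.swap) (simp add: Suc)
  finally show ?case by (simp add: oqw_trace[OF assms])
qed

lemma ergodic_tendsto:
  fixes B :: "'k::finite \<Rightarrow> 'k \<Rightarrow> 'n::finite cmat"
  assumes "ergodic B"
  shows "(\<lambda>r. block_power (block_rep B) r i j X) \<longlonglongrightarrow> Omega_op i j X"
proof -
  have Om: "Vector_Spaces.linear cscale cscale (Omega_op i j :: 'n cmat \<Rightarrow> 'n cmat)"
    by (rule linear_cscaleI)
       (simp_all add: Omega_op_def vec_eq_iff trace_add add_divide_distrib algebra_simps)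
  have "(\<lambda>r. block_power (block_rep B) r i j X $ a $ b) \<longlonglongrightarrow> Omega_op i j X $ a $ b" for a b
    unfolding linear_cscale_matrix_rep[OF linear_block_power] linear_cscale_matrix_rep[OF Om]
    using assms unfolding ergodic_def by (intro tendsto_sum tendsto_mult tendsto_const) blast
  then show ?thesis by (intro vec_tendstoI)
qed

section \<open>Geometric decay of survival\<close>

text \<open>Being at \<open>i\<close> at time \<open>Suc r\<close> and avoiding \<open>i\<close> at
  all times from 1 to \<open>Suc r\<close> are disjoint events, so their masses add up to at most
  the initial mass.\<close>

lemma trace_mult_adjoint_block_power:
  assumes "oqw B"
  shows "Re (trace (block_power (block_rep B) (Suc r) i j (Y ** adjoint_mat Y)))
     + survival B i (Suc r) j Y \<le> (norm Y)\<^sup>2"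
proof (induction r arbitrary: j Y)
  case 0
  have "(\<Sum>l\<in>UNIV. conj_map (B i l) (if l = j then Y ** adjoint_mat Y else 0))
     = (\<Sum>l\<in>UNIV. if l = j then conj_map (B i l) (Y ** adjoint_mat Y) else 0)"
    by (intro sum.cong refl) (simp add: conj_map_def)
  then have "Re (trace (block_power (block_rep B) (Suc 0) i j (Y ** adjoint_mat Y)))
     = (norm (B i j ** Y))\<^sup>2"
    by (simp add: block_mult_def block_one_def block_rep_def conj_map_mult_adjoint trace_mult_adjoint
        del: of_real_power)
  then show ?case
    using oqw_norm[OF assms, of j Y] by (simp add: sum.remove[of UNIV i])
next
  case (Suc r)
  let ?P = "\<lambda>l Z. Re (trace (block_power (block_rep B) (Suc r) i l (Z ** adjoint_mat Z)))"
  have "?P i Z \<le> (norm Z)\<^sup>2" for Z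
    using Suc[of i Z] survival_nonneg[of B i "Suc r" i Z] by linarith
  note this[of "B i j ** Y"]
  moreover have "Re (trace (block_power (block_rep B) (Suc (Suc r)) i j (Y ** adjoint_mat Y)))
      = (\<Sum>l\<in>UNIV. ?P l (B l j ** Y))"
    by (subst block_power_Suc_right) (simp only: conj_map_mult_adjoint trace_sum Re_sum)
  moreover have "\<dots> = ?P i (B i j ** Y) + (\<Sum>l\<in>UNIV-{i}. ?P l (B l j ** Y))"
    by (simp only: sum.remove[of UNIV i] finite UNIV_I)
  moreover have "(\<Sum>l\<in>UNIV-{i}. ?P l (B l j ** Y)) + (\<Sum>l\<in>UNIV-{i}. survival B i (Suc r) l (B l j ** Y))
      \<le> (\<Sum>l\<in>UNIV-{i}. (norm (B l j ** Y))\<^sup>2)"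
    unfolding sum.distrib[symmetric] by (intro sum_mono Suc)
  moreover have "(norm Y)\<^sup>2 = (norm (B i j ** Y))\<^sup>2 + (\<Sum>l\<in>UNIV-{i}. (norm (B l j ** Y))\<^sup>2)"
    using oqw_norm[OF assms, of j Y] by (simp add: sum.remove[of UNIV i])
  ultimately show ?case unfolding survival.simps(2)[of B i "Suc r"] by linarith
qed

text \<open>Ergodicity sends mass close to \<open>1 / k\<close> to site \<open>i\<close> at one large time, uniformly in the
  initial state, so what survives until then has lost a fixed fraction of its mass.\<close>

lemma survival_contraction:
  fixes B :: "'k::finite \<Rightarrow> 'k \<Rightarrow> 'n::finite cmat"
  assumes "oqw B" "ergodic B"
  shows "\<exists>r0>0. \<exists>a. 0 < a \<and> a < 1 \<and> (\<forall>j Y. survival B i r0 j Y \<le> a * (norm Y)\<^sup>2)"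
proof -
  define k where "k = real CARD('k)"
  have k: "k \<ge> 1" unfolding k_def by (simp add: Suc_leI)
  obtain K where K: "K > 0"
    "\<And>(X :: 'n cmat) (Y :: 'n cmat). norm (X ** adjoint_mat Y) \<le> K * ((norm X)\<^sup>2 + (norm Y)\<^sup>2)"
    using norm_mult_adjoint_bound by blast
  \<comment> \<open>\<open>L\<close> is the deviation of the mass at \<open>i\<close> from its
    limit; \<open>E\<close> collects it over the matrix units and so bounds the norm of the
    functional \<open>L r j\<close>.\<close>
  define L where "L r j X = trace (block_power (block_rep B) r i j X) - trace X / of_real k" for r j and X :: "'n cmat"
  define E where "E r j = (\<Sum>c\<in>UNIV. \<Sum>d\<in>UNIV. norm (L r j (axis c (axis d 1))))" for r j
  have "trace (Omega_op i j X :: 'n cmat) = trace X / of_real k" for j :: 'k and X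
    by (simp add: Omega_op_def trace_I k_def)
  then have "(\<lambda>r. L r j X) \<longlonglongrightarrow> 0" for j X
    unfolding L_def LIM_zero_iff
    using bounded_linear.tendsto[OF bounded_linear_trace ergodic_tendsto[OF assms(2)], of i j X] by simp
  \<comment> \<open>Summing over the finitely many starting sites yields one time that works for all
    of them.\<close>
  then have "(\<lambda>r. \<Sum>j\<in>UNIV. E r j) \<longlonglongrightarrow> 0"
    unfolding E_def by (intro tendsto_null_sum tendsto_norm_zero)
  \<comment> \<open>With \<open>norm (Y ** adjoint_mat Y)\<close> at most
    \<open>2 * K * (norm Y)\<^sup>2\<close>, this threshold keeps the deviation below half of the
    limiting mass \<open>(norm Y)\<^sup>2 / k\<close>.\<close>
  moreover have "1 / (4 * K * k) > 0" using K k by simp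
  ultimately have "\<forall>\<^sub>F r in sequentially. (\<Sum>j\<in>UNIV. E r j) < 1 / (4 * K * k)"
    by (rule order_tendstoD)
  then obtain r where "(\<Sum>j\<in>UNIV. E (Suc r) j) < 1 / (4 * K * k)"
    unfolding eventually_sequentially using le_SucI by blast
  moreover have "E (Suc r) j \<le> (\<Sum>j\<in>UNIV. E (Suc r) j)" for j
    by (rule member_le_sum) (auto simp: E_def intro!: sum_nonneg)
  ultimately have E: "E (Suc r) j \<le> 1 / (4 * K * k)" for j
    by (meson less_eq_real_def order_le_less_trans)
  have LE: "norm (L (Suc r) j X) \<le> E (Suc r) j * norm X" for j X
  proof -
    let ?f = "block_power (block_rep B) (Suc r) i j"
    have "L (Suc r) j X = (\<Sum>c\<in>UNIV. \<Sum>d\<in>UNIV. X $ c $ d * L (Suc r) j (axis c (axis d 1)))"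
      unfolding L_def
      by (subst linear_cscale_expansion[OF linear_block_power], subst (3) matrix_unit_expansion)
         (simp only: trace_sum trace_cscale right_diff_distrib sum_subtractf sum_divide_distrib times_divide_eq_right)
    also have "norm \<dots> \<le> (\<Sum>c\<in>UNIV. \<Sum>d\<in>UNIV. norm (X $ c $ d * L (Suc r) j (axis c (axis d 1))))"
      by (rule sum_norm_le) (rule norm_sum)
    also have "\<dots> \<le> (\<Sum>c\<in>UNIV. \<Sum>d\<in>UNIV. norm (L (Suc r) j (axis c (axis d 1))) * norm X)"
    proof (intro sum_mono)
      fix c d
      have "norm (X $ c $ d) \<le> norm X"
        by (rule order_trans[OF Finite_Cartesian_Product.norm_nth_le Finite_Cartesian_Product.norm_nth_le])
      then show "norm (X $ c $ d * L (Suc r) j (axis c (axis d 1))) \<le> norm (L (Suc r) j (axis c (axis d 1))) * norm X"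
        by (simp add: norm_mult mult.commute mult_right_mono)
    qed
    finally show ?thesis by (simp add: E_def sum_distrib_right)
  qed
  \<comment> \<open>Site \<open>i\<close> holds at least the fraction
    \<open>1 / k - 1 / (2 * k)\<close> of the mass, which is lost to survival.\<close>
  have "survival B i (Suc r) j Y \<le> (1 - 1 / (2 * k)) * (norm Y)\<^sup>2" for j Y
  proof -
    let ?X = "Y ** adjoint_mat Y"
    have "norm (L (Suc r) j ?X) \<le> E (Suc r) j * norm ?X" by (rule LE)
    also have "\<dots> \<le> 1 / (4 * K * k) * (K * ((norm Y)\<^sup>2 + (norm Y)\<^sup>2))"
      by (rule mult_mono[OF E K(2)]) (use K k in auto)
    also have "\<dots> = (norm Y)\<^sup>2 / (2 * k)" using K k by (simp add: field_simps)
    finally have "norm (L (Suc r) j ?X) \<le> (norm Y)\<^sup>2 / (2 * k)" .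
    moreover have "- norm (L (Suc r) j ?X) \<le> Re (L (Suc r) j ?X)"
      using abs_Re_le_cmod[of "L (Suc r) j ?X"] by linarith
    moreover have "Re (L (Suc r) j ?X) = Re (trace (block_power (block_rep B) (Suc r) i j ?X)) - (norm Y)\<^sup>2 / k"
      unfolding L_def trace_mult_adjoint by (simp only: minus_complex.sel of_real_divide[symmetric] Re_complex_of_real)
    moreover have "(1 - 1 / (2 * k)) * (norm Y)\<^sup>2 = (norm Y)\<^sup>2 - (norm Y)\<^sup>2 / k + (norm Y)\<^sup>2 / (2 * k)"
      using k by (simp add: field_simps)
    ultimately show ?thesis
      using trace_mult_adjoint_block_power[OF assms(1), of r i j Y] by linarith
  qed
  moreover have "0 < 1 - 1 / (2 * k)" "1 - 1 / (2 * k) < 1" using k by (simp_all add: field_simps)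
  ultimately show ?thesis by blast
qed

text \<open>The contraction by \<open>a\<close> over every \<open>r0\<close> steps is spread evenly
  by taking \<open>\<mu>\<close> as the \<open>r0\<close>-th root of \<open>a\<close>.\<close>

lemma survival_geometric:
  assumes "oqw B" "ergodic B"
  shows "\<exists>M \<mu>. 0 < \<mu> \<and> \<mu> < 1 \<and> (\<forall>r j Y. survival B i r j Y \<le> M * \<mu> ^ r * (norm Y)\<^sup>2)"
proof -
  obtain r0 a where r0: "r0 > 0" and a: "0 < a" "a < 1"
    and s: "\<And>j Y. survival B i r0 j Y \<le> a * (norm Y)\<^sup>2"
    using survival_contraction[OF assms] by blast
  define \<mu> where "\<mu> = root r0 a"
  have \<mu>: "0 < \<mu>" "\<mu> < 1" "\<mu> ^ r0 = a" using r0 a by (simp_all add: \<mu>_def)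
  \<comment> \<open>The \<open>t\<close> steps outside the complete blocks of length
    \<open>r0\<close> cost at most a factor 1.\<close>
  have iter: "survival B i (t + r0 * m) j Y \<le> a ^ m * (norm Y)\<^sup>2" for t m j Y
  proof (induction m)
    case 0
    then show ?case using survival_le[OF assms(1)] by simp
  next
    case (Suc m)
    have "survival B i ((t + r0 * m) + r0) j Y \<le> a * survival B i (t + r0 * m) j Y"
      by (rule survival_add_le) (rule s)
    also have "\<dots> \<le> a * (a ^ m * (norm Y)\<^sup>2)" using Suc a by simp
    finally show ?case by (simp add: algebra_simps)
  qed
  have "survival B i r j Y \<le> (1 / a) * \<mu> ^ r * (norm Y)\<^sup>2" for r j Y
  proof -
    \<comment> \<open>The incomplete block has fewer than \<open>r0\<close> steps, so counting it as
      decay as well costs at most the factor \<open>1 / a\<close>.\<close>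
    have "a = \<mu> ^ r0" using \<mu> by simp
    also have "\<dots> \<le> \<mu> ^ (r mod r0)"
      using r0 \<mu> by (intro power_decreasing) (auto intro: less_imp_le)
    finally have "a ^ (r div r0) * a \<le> a ^ (r div r0) * \<mu> ^ (r mod r0)"
      using a by simp
    also have "\<dots> = \<mu> ^ (r0 * (r div r0) + r mod r0)"
      by (simp only: power_add power_mult \<mu>(3))
    finally have "a ^ (r div r0) \<le> (1 / a) * \<mu> ^ r" using a by (simp add: field_simps)
    then have "a ^ (r div r0) * (norm Y)\<^sup>2 \<le> (1 / a) * \<mu> ^ r * (norm Y)\<^sup>2"
      by (intro mult_right_mono) auto
    with iter[of "r mod r0" "r div r0" j Y] show ?thesis by simp
  qed
  with \<mu> show ?thesis by blast
qed

text \<open>\<open>X\<close> is written as \<open>X ** adjoint_mat (mat 1)\<close>, which reduces an arbitrary matrix to the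
  survival probabilities of two positive ones.\<close>

lemma taboo_recursion_summable:
  fixes G :: "nat \<Rightarrow> 'k::finite \<Rightarrow> 'n::finite cmat \<Rightarrow> 'a::banach"
  assumes "oqw B" "ergodic B"
    and rec: "\<And>r j X. G (Suc r) j X = (\<Sum>l\<in>UNIV-{i}. G r l (conj_map (B l j) X))"
    and base: "\<And>j X Y. norm (G 0 j (X ** adjoint_mat Y)) \<le> K * ((norm X)\<^sup>2 + (norm Y)\<^sup>2)"
  shows "summable (\<lambda>r. of_nat (Suc r) *\<^sub>R G r j X)"
proof -
  obtain M \<mu> where \<mu>: "0 < \<mu>" "\<mu> < 1" and s: "\<And>r j Y. survival B i r j Y \<le> M * \<mu> ^ r * (norm Y)\<^sup>2"
    using survival_geometric[OF assms(1,2)] by blast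
  \<comment> \<open>The sign of \<open>K\<close> is read off from the base bound at two identity
    matrices.\<close>
  have "0 \<le> norm (G 0 j (mat 1 ** adjoint_mat (mat 1)))" by simp
  also have "\<dots> \<le> K * ((norm (mat 1 :: 'n cmat))\<^sup>2 + (norm (mat 1 :: 'n cmat))\<^sup>2)" by (rule base)
  finally have "0 \<le> K * (2 * (norm (mat 1 :: 'n cmat))\<^sup>2)" by simp
  moreover have "mat 1 \<noteq> (0 :: 'n cmat)" by (simp add: vec_eq_iff mat_def)
  then have "0 < (norm (mat 1 :: 'n cmat))\<^sup>2" by simp
  ultimately have K: "K \<ge> 0" by (simp add: zero_le_mult_iff)
  define C where "C = K * (M * ((norm X)\<^sup>2 + (norm (mat 1 :: 'n cmat))\<^sup>2))"
  have "norm (G r j X) \<le> C * \<mu> ^ r" for r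
  proof -
    have "norm (G r j (X ** adjoint_mat (mat 1))) \<le> K * (survival B i r j X + survival B i r j (mat 1))"
      by (rule taboo_recursion_bound[OF rec base])
    also have "\<dots> \<le> K * (M * \<mu> ^ r * (norm X)\<^sup>2 + M * \<mu> ^ r * (norm (mat 1 :: 'n cmat))\<^sup>2)"
      using K s by (intro mult_left_mono add_mono) auto
    finally show ?thesis by (simp add: C_def algebra_simps)
  qed
  then have bound: "norm (of_nat (Suc r) *\<^sub>R G r j X) \<le> C * (of_nat (Suc r) * \<mu> ^ r)" for r
    using mult_left_mono[of "norm (G r j X)" "C * \<mu> ^ r" "real (Suc r)"] by (simp add: mult_ac)
  \<comment> \<open>The majorant is a multiple of the derivative of the geometric series, whose
    ratio \<open>\<mu>\<close> lies below 1.\<close>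
  have "summable (\<lambda>r. C * (of_nat (Suc r) * \<mu> ^ r))"
    using geometric_deriv_sums[of \<mu>] \<mu> by (intro summable_mult) (simp add: sums_iff)
  then show ?thesis by (rule summable_comparison_test'[OF _ bound])
qed

section \<open>First-visit operators and convergence of the hitting series\<close>

text \<open>Index \<open>r\<close> stands for a first visit at time \<open>Suc r\<close>, matching
  the shifted series of \<open>hitting_op\<close>; the argument order lets
  \<open>first_visit_op B i\<close> stand for \<open>G\<close> in the taboo recursion.\<close>

definition first_visit_op ::
  "('k::finite \<Rightarrow> 'k \<Rightarrow> 'n::finite cmat) \<Rightarrow> 'k \<Rightarrow> nat \<Rightarrow> 'k \<Rightarrow> 'n cmat \<Rightarrow> 'n cmat" where
  "first_visit_op B i r j X = (\<Sum>s\<in>first_visit_walks i j (Suc r). conj_map (walk_product B s) X)"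

lemma finite_first_visit_walks: "finite (first_visit_walks (i::'k::finite) j r)"
  by (rule finite_subset[OF _ finite_lists_length_eq[of UNIV "Suc r"]]) (auto simp: first_visit_walks_def)

lemma first_visit_walks_1: "first_visit_walks i j (Suc 0) = {[j, i]}"
  by (auto simp: first_visit_walks_def length_Suc_conv)

text \<open>Deleting the starting site moves time 1 to time 0, so the constraint at time 1 becomes
  the condition \<open>l \<noteq> i\<close> on the new start.\<close>

lemma first_visit_walks_Suc:
  "first_visit_walks i j (Suc (Suc r)) = (\<Union>l\<in>UNIV-{i}. (#) j ` first_visit_walks i l (Suc r))"
proof (intro subset_antisym subsetI)
  fix s assume s: "s \<in> first_visit_walks i j (Suc (Suc r))"
  then obtain t where t: "s = j # t" "length t = Suc (Suc r)"
    by (cases s) (auto simp: first_visit_walks_def)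
  have "t ! m \<noteq> i" if "m < Suc r" for m
    using s that t(1) unfolding first_visit_walks_def by (auto dest: spec[of _ "Suc m"])
  then have "t ! 0 \<noteq> i" "t \<in> first_visit_walks i (t ! 0) (Suc r)"
    using s t by (auto simp: first_visit_walks_def)
  with t show "s \<in> (\<Union>l\<in>UNIV-{i}. (#) j ` first_visit_walks i l (Suc r))" by blast
next
  fix s assume "s \<in> (\<Union>l\<in>UNIV-{i}. (#) j ` first_visit_walks i l (Suc r))"
  then obtain l t where s: "s = j # t" and l: "l \<noteq> i" and t: "t \<in> first_visit_walks i l (Suc r)"
    by blast
  \<comment> \<open>Time 1 is the start \<open>l\<close> of \<open>t\<close>, on which membership of
    \<open>t\<close> imposes no avoidance; later times are interior times of
    \<open>t\<close>.\<close>
  have "s ! m \<noteq> i" if "1 \<le> m" "m < Suc (Suc r)" for m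
  proof (cases "m = 1")
    case True
    then show ?thesis using l t by (simp add: s first_visit_walks_def)
  next
    case False
    with that have "1 \<le> m - 1" "m - 1 < Suc r" by auto
    with t have "t ! (m - 1) \<noteq> i" unfolding first_visit_walks_def by blast
    then show ?thesis using that by (simp add: s nth_Cons')
  qed
  then show "s \<in> first_visit_walks i j (Suc (Suc r))"
    using t by (simp add: s first_visit_walks_def)
qed

lemma first_visit_op_0: "first_visit_op B i 0 j X = conj_map (B i j) X"
  by (simp add: first_visit_op_def first_visit_walks_1)

text \<open>Walks with different second sites \<open>l\<close> are distinct, and the first step
  contributes the rightmost factor \<open>B l j\<close>, which acts first under conjugation.\<close>

lemma first_visit_op_Suc:
  "first_visit_op B i (Suc r) j X = (\<Sum>l\<in>UNIV-{i}. first_visit_op B i r l (conj_map (B l j) X))"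
proof -
  have "first_visit_op B i (Suc r) j X
     = (\<Sum>l\<in>UNIV-{i}. \<Sum>s\<in>(#) j ` first_visit_walks i l (Suc r). conj_map (walk_product B s) X)"
    unfolding first_visit_op_def first_visit_walks_Suc
    by (intro sum.UNION_disjoint ballI finite_imageI finite_first_visit_walks)
       (auto simp: first_visit_walks_def)
  also have "\<dots> = (\<Sum>l\<in>UNIV-{i}. first_visit_op B i r l (conj_map (B l j) X))"
  proof (rule sum.cong[OF refl])
    fix l
    have "conj_map (walk_product B (j # s)) X = conj_map (walk_product B s) (conj_map (B l j) X)"
      if "s \<in> first_visit_walks i l (Suc r)" for s
    proof -
      obtain u where "s = l # u" using \<open>s \<in> _\<close> by (cases s) (auto simp: first_visit_walks_def)
      then show ?thesis by (simp add: conj_map_mult)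
    qed
    then show "(\<Sum>s\<in>(#) j ` first_visit_walks i l (Suc r). conj_map (walk_product B s) X)
        = first_visit_op B i r l (conj_map (B l j) X)"
      by (simp add: first_visit_op_def sum.reindex)
  qed
  finally show ?thesis .
qed

lemma linear_first_visit_op: "linear (first_visit_op B i r j)"
  unfolding first_visit_op_def
  by (intro linear_compose_sum ballI linear_cscale_imp_linear linear_conj_map)

lemma hitting_op_eq: "hitting_op B i j X = (\<Sum>r. of_nat (Suc r) *\<^sub>R first_visit_op B i r j X)"
  by (simp add: hitting_op_def first_visit_op_def)

lemma summable_first_visit_op:
  fixes B :: "'k::finite \<Rightarrow> 'k \<Rightarrow> 'n::finite cmat"
  assumes "oqw B" "ergodic B"
  shows "summable (\<lambda>r. of_nat (Suc r) *\<^sub>R first_visit_op B i r j X)"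
proof -
  obtain K where K: "K > 0"
    "\<And>(X :: 'n cmat) (Y :: 'n cmat). norm (X ** adjoint_mat Y) \<le> K * ((norm X)\<^sup>2 + (norm Y)\<^sup>2)"
    using norm_mult_adjoint_bound by blast
  \<comment> \<open>One term of \<open>oqw_norm\<close> is at most the whole sum, so entering
    \<open>i\<close> does not enlarge either factor.\<close>
  have step: "(norm (B i j ** X))\<^sup>2 \<le> (norm X)\<^sup>2" for j and X :: "'n cmat"
    unfolding oqw_norm[OF assms(1), of j X, symmetric] by (rule member_le_sum) auto
  have "norm (first_visit_op B i 0 j (X ** adjoint_mat Y)) \<le> K * ((norm X)\<^sup>2 + (norm Y)\<^sup>2)" for j X Y
    unfolding first_visit_op_0 conj_map_mult_adjoint
    using K(2)[of "B i j ** X" "B i j ** Y"] step[of j X] step[of j Y] K(1)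
    by (meson add_mono less_imp_le mult_left_mono order_trans)
  then show ?thesis
    by (rule taboo_recursion_summable[where G = "first_visit_op B i", OF assms first_visit_op_Suc])
qed

lemma linear_hitting_op:
  assumes "oqw B" "ergodic B"
  shows "linear (hitting_op B i j)"
proof (rule linearI)
  show "hitting_op B i j (X + Y) = hitting_op B i j X + hitting_op B i j Y" for X Y
    unfolding hitting_op_eq linear_add[OF linear_first_visit_op] scaleR_add_right
    by (rule suminf_add[symmetric]) (rule summable_first_visit_op[OF assms])+
  show "hitting_op B i j (c *\<^sub>R X) = c *\<^sub>R hitting_op B i j X" for c X
    unfolding hitting_op_eq linear_scale[OF linear_first_visit_op] scaleR_left_commute[of _ c]
    by (rule bounded_linear.suminf[OF bounded_linear_scaleR_right, symmetric])
       (rule summable_first_visit_op[OF assms])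
qed

section \<open>Recurrence and first-step analysis under the trace\<close>

lemma trace_hitting_op_sums:
  assumes "oqw B" "ergodic B"
  shows "(\<lambda>r. of_nat (Suc r) * trace (first_visit_op B i r j X)) sums trace (hitting_op B i j X)"
  using bounded_linear.sums[OF bounded_linear_trace summable_sums[OF summable_first_visit_op[OF assms, of i j X]]]
  by (simp add: hitting_op_eq scaleR_eq_cscale del: of_nat_Suc)

text \<open>Site \<open>i\<close> is visited almost surely: the remainder \<open>T R\<close> is the
  mass that has avoided \<open>i\<close> up to time \<open>R\<close>, and it obeys the taboo
  recursion.\<close>

lemma trace_first_visit_op_sums:
  fixes B :: "'k::finite \<Rightarrow> 'k \<Rightarrow> 'n::finite cmat"
  assumes "oqw B" "ergodic B"
  shows "(\<lambda>r. trace (first_visit_op B i r j X)) sums trace X"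
proof -
  define T where "T R j X = trace X - (\<Sum>r<R. trace (first_visit_op B i r j X))" for R j X
  have rec: "T (Suc R) j X = (\<Sum>l\<in>UNIV-{i}. T R l (conj_map (B l j) X))" for R j X
  proof -
    have "trace X - trace (conj_map (B i j) X) = (\<Sum>l\<in>UNIV-{i}. trace (conj_map (B l j) X))"
      using oqw_trace[OF assms(1), of j X] by (simp add: sum.remove[of UNIV i] algebra_simps)
    moreover have "(\<Sum>r<Suc R. trace (first_visit_op B i r j X))
      = trace (conj_map (B i j) X) + (\<Sum>r<R. \<Sum>l\<in>UNIV-{i}. trace (first_visit_op B i r l (conj_map (B l j) X)))"
      by (simp only: sum.lessThan_Suc_shift first_visit_op_0 first_visit_op_Suc trace_sum)
    moreover have "(\<Sum>r<R. \<Sum>l\<in>UNIV-{i}. trace (first_visit_op B i r l (conj_map (B l j) X)))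
      = (\<Sum>l\<in>UNIV-{i}. \<Sum>r<R. trace (first_visit_op B i r l (conj_map (B l j) X)))"
      by (rule sum.swap)
    ultimately show ?thesis by (simp add: T_def sum_subtractf)
  qed
  obtain K where K: "K > 0"
    "\<And>(X :: 'n cmat) (Y :: 'n cmat). norm (X ** adjoint_mat Y) \<le> K * ((norm X)\<^sup>2 + (norm Y)\<^sup>2)"
    using norm_mult_adjoint_bound by blast
  obtain L where L: "L > 0" "\<And>X :: 'n cmat. norm (trace X) \<le> norm X * L"
    using bounded_linear.pos_bounded[OF bounded_linear_trace] by blast
  have base: "norm (T 0 j (X ** adjoint_mat Y)) \<le> (K * L) * ((norm X)\<^sup>2 + (norm Y)\<^sup>2)" for j X Y
  proof -
    have "norm (T 0 j (X ** adjoint_mat Y)) \<le> norm (X ** adjoint_mat Y) * L"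
      using L(2) by (simp add: T_def)
    also have "\<dots> \<le> K * ((norm X)\<^sup>2 + (norm Y)\<^sup>2) * L"
      using K L by (intro mult_right_mono) auto
    finally show ?thesis by (simp add: mult_ac)
  qed
  have "summable (\<lambda>R. of_nat (Suc R) *\<^sub>R T R j X)"
    by (rule taboo_recursion_summable[OF assms rec base])
  \<comment> \<open>The terms of the convergent series tend to 0, and they dominate
    \<open>T R j X\<close> because the weight \<open>Suc R\<close> is at least 1.\<close>
  then have lim: "(\<lambda>R. of_nat (Suc R) *\<^sub>R T R j X) \<longlonglongrightarrow> 0" by (rule summable_LIMSEQ_zero)
  have "(\<lambda>R. T R j X) \<longlonglongrightarrow> 0"
  proof (rule tendsto_0_le[OF lim, where K = 1])
    show "\<forall>\<^sub>F R in sequentially. norm (T R j X) \<le> norm (of_nat (Suc R) *\<^sub>R T R j X) * 1"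
    proof (intro always_eventually allI)
      fix R
      show "norm (T R j X) \<le> norm (of_nat (Suc R) *\<^sub>R T R j X) * 1"
        using mult_right_mono[of 1 "real (Suc R)" "norm (T R j X)"] by simp
    qed
  qed
  then have "(\<lambda>R. trace X - T R j X) \<longlonglongrightarrow> trace X - 0" by (intro tendsto_intros)
  then show ?thesis by (simp add: T_def sums_def)
qed

text \<open>After a first step that misses \<open>i\<close>, the hitting time is one plus the
  remaining time. The extra ones, together with the walks that hit \<open>i\<close> at once, sum to
  the total mass \<open>trace X\<close>.\<close>

lemma trace_hitting_op_first_step:
  assumes "oqw B" "ergodic B"
  shows "trace (hitting_op B i j X)
     = trace X + (\<Sum>l\<in>UNIV-{i}. trace (hitting_op B i l (conj_map (B l j) X)))"
proof -
  let ?t = "\<lambda>r. trace (first_visit_op B i r j X)"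
  have "(\<lambda>r. \<Sum>l\<in>UNIV-{i}. of_nat (Suc r) * trace (first_visit_op B i r l (conj_map (B l j) X)))
     sums (\<Sum>l\<in>UNIV-{i}. trace (hitting_op B i l (conj_map (B l j) X)))"
    by (rule sums_sum) (rule trace_hitting_op_sums[OF assms])
  then have "(\<lambda>r. of_nat (Suc r) * ?t (Suc r)) sums (\<Sum>l\<in>UNIV-{i}. trace (hitting_op B i l (conj_map (B l j) X)))"
    by (simp only: first_visit_op_Suc trace_sum sum_distrib_left)
  moreover have shift: "g sums s \<Longrightarrow> (\<lambda>r. g (Suc r)) sums (s - g 0)" for g :: "nat \<Rightarrow> complex" and s
    by (simp add: sums_Suc_iff)
  have "(\<lambda>r. ?t (Suc r)) sums (trace X - ?t 0)"
    by (rule shift[OF trace_first_visit_op_sums[OF assms]])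
  ultimately have "(\<lambda>r. ?t (Suc r) + of_nat (Suc r) * ?t (Suc r))
     sums (trace X - ?t 0 + (\<Sum>l\<in>UNIV-{i}. trace (hitting_op B i l (conj_map (B l j) X))))"
    by (intro sums_add)
  \<comment> \<open>Dropping term 0, which has weight 1, leaves weight \<open>r + 2\<close> at index
    \<open>r\<close>; it splits into the extra step and the remaining time.\<close>
  moreover have "of_nat (Suc (Suc r)) * z = z + of_nat (Suc r) * z" for r and z :: complex
    by (simp add: algebra_simps)
  then have "(\<lambda>r. ?t (Suc r) + of_nat (Suc r) * ?t (Suc r)) sums (trace (hitting_op B i j X) - ?t 0)"
    using shift[OF trace_hitting_op_sums[OF assms, of i j X]] by simp
  ultimately have "trace (hitting_op B i j X) - ?t 0
      = trace X - ?t 0 + (\<Sum>l\<in>UNIV-{i}. trace (hitting_op B i l (conj_map (B l j) X)))"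
    by (rule sums_unique2[rotated])
  then show ?thesis by (simp add: algebra_simps)
qed

section \<open>The inverse diagonal and independence of the starting site\<close>

text \<open>Block \<open>(i, l)\<close> of the right-inverse identity involves only the diagonal
  entry at \<open>i\<close>; taking traces there turns this entry into multiplication by
  \<open>c\<close>.\<close>

lemma trace_block_inv_hitting_diag:
  assumes "block_invertible (hitting_diag B)"
    and c: "\<And>i \<eta>. trace (hitting_op B i i \<eta>) = c * trace \<eta>"
  shows "trace (block_inv (hitting_diag B) i l X) = (if i = l then trace X / c else 0)"
proof -
  define E where "E = block_inv (hitting_diag B)"
  have "is_block_inverse (hitting_diag B) E"
    using assms(1) unfolding E_def block_inv_def block_invertible_def by (rule someI_ex)
  then have "block_mult (hitting_diag B) E i l X = block_one i l X" for i l X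
    by (simp add: is_block_inverse_def)
  then have "(\<Sum>m\<in>UNIV. hitting_diag B i m (E m l X)) = (if i = l then X else 0)" for i l X
    by (simp only: block_mult_def block_one_def)
  then have "hitting_op B i i (E i l X) = (if i = l then X else 0)" for i l X
    by (simp add: hitting_diag_def)
  then have "trace (hitting_op B i i (E i l X)) = trace (if i = l then X else 0)" for i l X
    by (simp only:)
  then have E: "c * trace (E i l X) = trace (if i = l then X else 0)" for i l X
    by (simp only: c)
  \<comment> \<open>On the identity matrix with \<open>i = l\<close> the right side is the
    dimension, which is nonzero.\<close>
  have "c \<noteq> 0" using E[of i i "mat 1"] by (auto simp: trace_I)
  moreover have "trace (0 :: 'b cmat) = 0" by (simp add: trace_def)
  ultimately show ?thesis using E[of i l X] unfolding E_def[symmetric]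
    by (auto simp: field_simps)
qed

theorem corollary2p6:
  fixes B :: "'k::finite \<Rightarrow> 'k \<Rightarrow> complex^'n::finite^'n"
  assumes "CARD('n) \<ge> 2" and "CARD('k) \<ge> 2"
    and "oqw B" and "ergodic B"
    and "block_invertible (hitting_diag B)"
    and "\<exists>c::complex. \<forall>i \<eta>. trace (hitting_op B i i \<eta>) = c * trace \<eta>"
  shows "\<forall>\<rho>. density_matrix \<rho> \<longrightarrow> (\<forall>j j'. target_time B j \<rho> = target_time B j' \<rho>)"
proof (intro allI impI)
  fix \<rho> :: "complex^'n^'n" and j j' :: 'k
  obtain c where c: "\<And>i \<eta>. trace (hitting_op B i i \<eta>) = c * trace \<eta>" using assms(6) by blast
  let ?P = "block_power (block_rep B)"
  define f where "f j X = (\<Sum>i\<in>UNIV-{j}. trace (hitting_op B i j X))" for j X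
  define d where "d = of_nat CARD('k) - c"
  have target: "target_time B j X = f j X / c" for j X
  proof -
    have "target_time B j X = (\<Sum>i\<in>UNIV. trace (hitting_offdiag B i j X) / c)"
      by (simp add: target_time_def block_mult_def trace_sum trace_block_inv_hitting_diag[OF assms(5) c])
    also have "\<dots> = (\<Sum>i\<in>UNIV-{j}. trace (hitting_offdiag B i j X) / c)"
      by (rule sum.mono_neutral_right) (auto simp: hitting_offdiag_def hitting_diag_def trace_def)
    also have "\<dots> = f j X / c"
      unfolding f_def sum_divide_distrib
      by (intro sum.cong refl) (auto simp: hitting_offdiag_def hitting_diag_def)
    finally show ?thesis .
  qed
  have lin: "linear (f j)" for j
    unfolding f_def
    by (intro linear_compose_sum ballI)
       (rule linear_compose[OF linear_hitting_op[OF assms(3,4)] bounded_linear.linear[OF bounded_linear_trace], unfolded o_def])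
  \<comment> \<open>Adding the return term \<open>c * trace X\<close> completes \<open>f j X\<close>
    to a sum over all targets, and each of these contributes one \<open>trace X\<close>; hence the
    constant \<open>d\<close>.\<close>
  have step: "f j X = d * trace X + (\<Sum>l\<in>UNIV. f l (conj_map (B l j) X))" for j X
  proof -
    have "f j X + c * trace X = (\<Sum>i\<in>UNIV. trace (hitting_op B i j X))"
      by (simp add: f_def c sum.remove[of UNIV j "\<lambda>i. trace (hitting_op B i j X)"])
    also have "\<dots> = (\<Sum>i\<in>UNIV. trace X + (\<Sum>l\<in>UNIV-{i}. trace (hitting_op B i l (conj_map (B l j) X))))"
      by (rule sum.cong[OF refl]) (rule trace_hitting_op_first_step[OF assms(3,4)])
    also have "\<dots> = of_nat CARD('k) * trace X
        + (\<Sum>i\<in>UNIV. \<Sum>l\<in>UNIV-{i}. trace (hitting_op B i l (conj_map (B l j) X)))"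
      by (simp add: sum.distrib)
    \<comment> \<open>Exchanging the sums, the pairs with \<open>l \<noteq> i\<close> regroup by
      \<open>l\<close>, and the targets \<open>i\<close> other than \<open>l\<close> make up
      \<open>f l\<close>.\<close>
    also have "(\<Sum>i\<in>UNIV. \<Sum>l\<in>UNIV-{i}. trace (hitting_op B i l (conj_map (B l j) X)))
        = (\<Sum>l\<in>UNIV. f l (conj_map (B l j) X))"
    proof -
      have "{l \<in> UNIV. l \<noteq> i} = UNIV - {i}" "{l \<in> UNIV. i \<noteq> l} = UNIV - {i}" for i :: 'k by auto
      then show ?thesis
        using sum.swap_restrict[of UNIV UNIV "\<lambda>i l. trace (hitting_op B i l (conj_map (B l j) X))" "\<lambda>i l. l \<noteq> i"]
        by (simp only: f_def finite simp_thms)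
    qed
    finally show ?thesis by (simp add: d_def algebra_simps)
  qed
  \<comment> \<open>Every power preserves the total trace, so each further step adds the same
    \<open>d * trace X\<close>, whatever the starting site.\<close>
  have iter: "f j X = of_nat r * d * trace X + (\<Sum>l\<in>UNIV. f l (?P r l j X))" for r j X
  proof (induction r)
    case 0
    have "(\<Sum>l\<in>UNIV. f l (if l = j then X else 0)) = (\<Sum>l\<in>UNIV. if l = j then f l X else 0)"
      by (intro sum.cong refl) (simp add: linear_0[OF lin])
    then show ?case by (simp add: block_one_def)
  next
    case (Suc r)
    have "(\<Sum>m\<in>UNIV. f m (?P r m j X))
        = (\<Sum>m\<in>UNIV. d * trace (?P r m j X) + (\<Sum>l\<in>UNIV. f l (conj_map (B l m) (?P r m j X))))"
      by (rule sum.cong[OF refl]) (rule step)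
    also have "\<dots> = d * trace X + (\<Sum>m\<in>UNIV. \<Sum>l\<in>UNIV. f l (conj_map (B l m) (?P r m j X)))"
      by (simp only: sum.distrib sum_distrib_left[symmetric] trace_block_power[OF assms(3)])
    also have "(\<Sum>m\<in>UNIV. \<Sum>l\<in>UNIV. f l (conj_map (B l m) (?P r m j X)))
        = (\<Sum>l\<in>UNIV. \<Sum>m\<in>UNIV. f l (conj_map (B l m) (?P r m j X)))"
      by (rule sum.swap)
    also have "\<dots> = (\<Sum>l\<in>UNIV. f l (?P (Suc r) l j X))"
      by (simp only: block_power_block_rep_Suc linear_sum[OF lin])
    finally show ?case using Suc by (simp add: algebra_simps)
  qed
  have "(\<lambda>r. \<Sum>l\<in>UNIV. f l (?P r l j \<rho>)) \<longlonglongrightarrow> (\<Sum>l\<in>UNIV. f l (Omega_op l j \<rho>))" for j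
    by (rule tendsto_sum)
       (rule bounded_linear.tendsto[OF lin[unfolded linear_conv_bounded_linear] ergodic_tendsto[OF assms(4)]])
  from tendsto_diff[OF this[of j] this[of j']]
  have "(\<lambda>r. (\<Sum>l\<in>UNIV. f l (?P r l j \<rho>)) - (\<Sum>l\<in>UNIV. f l (?P r l j' \<rho>))) \<longlonglongrightarrow> 0"
    by (simp add: Omega_op_def)
  \<comment> \<open>The drift terms cancel, so the sequence tending to 0 is constant.\<close>
  moreover have "(\<Sum>l\<in>UNIV. f l (?P r l j \<rho>)) - (\<Sum>l\<in>UNIV. f l (?P r l j' \<rho>)) = f j \<rho> - f j' \<rho>" for r
    using iter[of j \<rho> r] iter[of j' \<rho> r] by (simp add: algebra_simps)
  ultimately have "f j \<rho> - f j' \<rho> = 0" by (simp add: LIMSEQ_const_iff)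
  then show "target_time B j \<rho> = target_time B j' \<rho>" by (simp add: target)
qed

end
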